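(* Let $k\ge 4$ be an integer. For $t\in\mathbb{Z}^+$ let $\mathcal{G}_{k,t}$ be the family of all connected graphs $G$ with minimum degree at least $k$ and girth at least $2t+1$. Then $$\lim_{t\to\infty}\ \sup_{G\in\mathcal{G}_{k,t}}\frac{\pi^*(G)}{|V(G)|}=0.$$
   Context: All graphs are finite and simple. A pebbling distribution $D$ on a graph $G$ is a function $D:V(G)\to\mathbb{Z}_{\ge 0}$; its size is $|D|=\sum_v D(v)$. A pebbling move removes two pebbles from a vertex having at least two pebbles and places one pebble on an adjacent vertex. A vertex $v$ is reachable under $D$ if some sequence of legal pebbling moves puts at least one pebble on $v$. $D$ is solvable if every vertex is reachable. The optimal pebbling number $\pi^*(G)$ is the minimum size of a solvable distribution on $G$. The girth is the length of a shortest cycle (infinite for acyclic graphs). *)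

theory Defs
  imports
    "HOL-Library.Extended_Nat"
    "HOL-Library.Extended_Nonnegative_Real"
    "Graph_Theory.Pair_Digraph"
    "Graph_Theory.Digraph_Component"
begin

(* A finite simple graph is a pair_graph: a finite vertex set together with a finite, symmetric,
   irreflexive set of ordered pairs. Each undirected edge contributes both of its orientations,
   so the out-degree of a vertex is its degree. *)

definition min_degree :: "'v pair_pre_digraph \<Rightarrow> nat" where
  "min_degree G = Min (out_degree (with_proj G) ` pverts G)"

(* The library's notion of cycle is the directed one, which in a symmetric digraph admits
   u, v, u; requiring at least three arcs leaves exactly the cycles of the undirected graph.
   The infimum of the empty set in enat is infinity, as wanted for acyclic graphs. *)
definition girth :: "'v pair_pre_digraph \<Rightarrow> enat" where
  "girth G = (INF p \<in> {p. pre_digraph.cycle (with_proj G) p \<and> 3 \<le> length p}. enat (length p))"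

(* Pebbling distributions are total functions on the vertex type; their values outside the
   vertex set are ignored by the notions below. *)

definition dist_size :: "'v pair_pre_digraph \<Rightarrow> ('v \<Rightarrow> nat) \<Rightarrow> nat" where
  "dist_size G D = (\<Sum>v\<in>pverts G. D v)"

inductive pebbling_move :: "'v pair_pre_digraph \<Rightarrow> ('v \<Rightarrow> nat) \<Rightarrow> ('v \<Rightarrow> nat) \<Rightarrow> bool"
  for G where
  "(u, v) \<in> parcs G \<Longrightarrow> 2 \<le> D u \<Longrightarrow> pebbling_move G D (D(u := D u - 2, v := D v + 1))"

definition pebbling_reachable :: "'v pair_pre_digraph \<Rightarrow> ('v \<Rightarrow> nat) \<Rightarrow> 'v \<Rightarrow> bool" where
  "pebbling_reachable G D v \<longleftrightarrow> (\<exists>D'. (pebbling_move G)\<^sup>*\<^sup>* D D' \<and> 1 \<le> D' v)"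

definition solvable :: "'v pair_pre_digraph \<Rightarrow> ('v \<Rightarrow> nat) \<Rightarrow> bool" where
  "solvable G D \<longleftrightarrow> (\<forall>v\<in>pverts G. pebbling_reachable G D v)"

definition optimal_pebbling_number :: "'v pair_pre_digraph \<Rightarrow> nat" where
  "optimal_pebbling_number G = (LEAST n. \<exists>D. solvable G D \<and> dist_size G D = n)"

(* The name connected is qualified because it also denotes topological connectedness;
   graph connectedness includes that the vertex set is nonempty. *)
definition graph_family :: "nat \<Rightarrow> nat \<Rightarrow> 'v pair_pre_digraph set" where
  "graph_family k t = {G. pair_graph G \<and> Digraph_Component.connected (with_proj G) \<and>
     k \<le> min_degree G \<and> enat (2 * t + 1) \<le> girth G}"

end

theory Submission
  imports Defs "Graph_Theory.Kuratowski"
begin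

text \<open>In a graph of minimum degree at least 4 and girth greater than 2t, the non-backtracking walks
  of length t from a vertex have distinct endpoints, so at least 3^t vertices are at the end of a
  walk of length t. A greedy choice therefore gives about n(t + 1)/3^t centres that reach all but
  n exp(-t) of the n vertices by walks of length t. Putting 2^t pebbles on each centre and one
  pebble on each vertex left over bounds the ratio by (t + 1)(2/3)^t + exp(-t).\<close>

section \<open>Non-backtracking walks\<close>

text \<open>Strong induction on the length: a repeated vertex cuts out a shorter closed walk, and a
  contiguous piece of a non-backtracking walk is non-backtracking. \<open>progressing\<close> says
  nothing about the turn from the last arc back to the first, so a walk out along a tail, round a
  cycle and back is covered too.\<close>

lemma (in pair_graph) progressing_closed_walk_imp_cycle:
  assumes "awalk u p u" "p \<noteq> []" "progressing p"
  shows "\<exists>q. cycle q \<and> 3 \<le> length q \<and> length q \<le> length p"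
  using assms
proof (induction "length p" arbitrary: u p rule: less_induct)
  case less
  show ?case
  proof (cases "distinct (tl (awalk_verts u p))")
    case True
    then have "cycle p"
      using less.prems by (auto simp: cycle_def)
    \<comment> \<open>One arc would be a loop, and two arcs would be an arc followed by its
      reverse.\<close>
    moreover have "3 \<le> length p"
    proof (rule ccontr)
      assume "\<not> 3 \<le> length p"
      then have "length p = 1 \<or> length p = 2"
        using \<open>p \<noteq> []\<close> length_0_conv[of p] by linarith
      then show False
        using less.prems
        by (fastforce simp: length_Suc_conv numeral_2_eq_2 awalk_simps progressing_Cons
            dest: pair_no_loops)
    qed
    ultimately show ?thesis by blast
  next
    case False
    \<comment> \<open>Without the first arc, the start \<open>u\<close> is no longer counted twice.
      The repetition therefore lies inside \<open>es\<close>, and the closed piece \<open>r\<close>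
      is strictly shorter than \<open>p\<close>.\<close>
    then obtain e es where p: "p = e # es" by (cases p) auto
    with False less.prems have "awalk (snd e) es u" "\<not> distinct (awalk_verts (snd e) es)"
      by (auto simp: awalk_Cons_iff)
    then obtain q r s w where es: "es = q @ r @ s" and r: "awalk w r w" "r \<noteq> []"
      by (metis awalk_not_distinct_decomp length_0_conv less_nat_zero_code)
    have "progressing r"
      using less.prems(3) unfolding p es
      by (metis progressing_ConsD progressing_appendD1 progressing_appendD2)
    with r less.hyps[of r w] show ?thesis
      by (fastforce simp: p es)
  qed
qed

lemma length_rev_path [simp]: "length (rev_path p) = length p"
  by (induction p) auto

lemma girth_le_cycle_length:
  assumes "pre_digraph.cycle (with_proj G) p" "3 \<le> length p"
  shows "girth G \<le> enat (length p)"
  unfolding girth_def using assms by (intro INF_lower) auto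

text \<open>If the last arcs of p and q differ, p followed by the reverse of q is
  a non-backtracking closed walk; otherwise the common last arc can be removed from both.\<close>

lemma (in pair_graph) progressing_walk_unique:
  assumes "awalk u p v" "awalk u q v" "progressing p" "progressing q"
    and "length p = length q" "enat (2 * length p) < girth G"
  shows "p = q"
  using assms
proof (induction p arbitrary: q v rule: rev_induct)
  case Nil
  then show ?case by simp
next
  case (snoc e p)
  from snoc.prems(5) obtain f q' where q: "q = q' @ [f]"
    by (cases q rule: rev_cases) auto
  have heads: "snd e = v" "snd f = v" "e \<in> parcs G" "f \<in> parcs G"
    using snoc.prems(1,2) by (auto simp: q awalk_simps)
  show ?case
  proof (cases "e = f")
    case True
    have "awalk u p (fst e)" "awalk u q' (fst e)"
      using snoc.prems(1,2) True by (auto simp: q awalk_simps)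
    moreover have "progressing p" "progressing q'"
      using snoc.prems(3,4) q progressing_appendD1 by blast+
    moreover have "enat (2 * length p) < girth G"
      using snoc.prems(6) by (rule order.strict_trans1[rotated]) simp
    ultimately have "p = q'"
      using snoc.IH snoc.prems(5) q by simp
    with True q show ?thesis by simp
  next
    case False
    let ?c = "(p @ [e]) @ rev_path q"
    have "awalk u ?c u"
      using snoc.prems(1,2) by (intro awalk_appendI) auto
    moreover have "progressing ?c"
      using snoc.prems(3) progressing_rev_path[of q] snoc.prems(4) False heads
      by (subst progressing_append_iff) (auto simp: q prod_eq_iff)
    ultimately obtain c where c: "cycle c" "3 \<le> length c" "length c \<le> length ?c"
      using progressing_closed_walk_imp_cycle[of u ?c] by auto
    have "girth G \<le> enat (length c)"
      using c by (intro girth_le_cycle_length) auto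
    also have "\<dots> \<le> enat (2 * length (p @ [e]))"
      using c(3) snoc.prems(5) by simp
    finally show ?thesis using snoc.prems(6) by simp
  qed
qed

text \<open>Lets domination and pebbling speak only of a relation. The assumption on
  \<open>u\<close> matters for \<open>t = 0\<close>, where the relation power is the identity on the
  whole type.\<close>

lemma (in pair_wf_digraph) relpow_iff_awalk:
  assumes "u \<in> pverts G"
  shows "(u, v) \<in> parcs G ^^ t \<longleftrightarrow> (\<exists>p. awalk u p v \<and> length p = t)"
  using assms
proof (induction t arbitrary: u)
  case 0
  then show ?case by (auto simp: awalk_simps)
next
  case (Suc t)
  have "(u, v) \<in> parcs G ^^ Suc t \<longleftrightarrow> (\<exists>w. (u, w) \<in> parcs G \<and> (w, v) \<in> parcs G ^^ t)"
    by (metis relpow_Suc_D2 relpow_Suc_I2)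
  also have "\<dots> \<longleftrightarrow> (\<exists>w. (u, w) \<in> parcs G \<and> (\<exists>p. awalk w p v \<and> length p = t))"
    using Suc.IH in_arcsD2 by blast
  also have "\<dots> \<longleftrightarrow> (\<exists>p. awalk u p v \<and> length p = Suc t)" (is "?L \<longleftrightarrow> ?R")
  proof
    assume ?L
    then obtain w p where "(u, w) \<in> parcs G" "awalk w p v" "length p = t" by blast
    then show ?R by (intro exI[of _ "(u, w) # p"]) (simp add: awalk_Cons_iff)
  next
    assume ?R
    then obtain w p where "awalk u ((u, w) # p) v" "length p = t"
      by (auto simp: length_Suc_conv awalk_Cons_iff)
    then show ?L by (auto simp: awalk_Cons_iff)
  qed
  finally show ?case .
qed

section \<open>Counting non-backtracking walks\<close>

definition progressing_walks :: "'v pair_pre_digraph \<Rightarrow> 'v \<Rightarrow> nat \<Rightarrow> ('v \<times> 'v) list set" where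
  "progressing_walks G u t =
     {p. (\<exists>v. pre_digraph.awalk (with_proj G) u p v) \<and> progressing p \<and> length p = t}"

lemma (in pair_fin_digraph) finite_progressing_walks: "finite (progressing_walks G u t)"
  by (rule finite_subset[OF _ finite_lists_length_eq[OF pair_finite_arcs, of t]])
    (auto simp: progressing_walks_def awalk_def)

text \<open>A non-backtracking walk can be extended by every arc out of its end except the reverse
  of its last arc, which leaves at least \<open>k - 1\<close> choices. Different walks or different
  choices give different extensions.\<close>

lemma (in pair_graph) card_progressing_walks_ge:
  assumes deg: "\<And>v. v \<in> pverts G \<Longrightarrow> k \<le> out_degree G v" and u: "u \<in> pverts G"
  shows "(k - 1) ^ t \<le> card (progressing_walks G u t)"
proof (induction t)
  case 0
  have "progressing_walks G u 0 = {[]}"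
    using u by (auto simp: progressing_walks_def awalk_simps progressing_Nil)
  then show ?case by simp
next
  case (Suc t)
  define ext where
    "ext p = {e \<in> out_arcs G (awlast u p). p = [] \<or> snd e \<noteq> fst (last p)}" for p
  have ext_ge: "k - 1 \<le> card (ext p)" if "p \<in> progressing_walks G u t" for p
  proof -
    have "awlast u p \<in> pverts G"
      using that by (auto simp: progressing_walks_def)
    then have "k - 1 \<le> card (out_arcs G (awlast u p)) - 1"
      using deg by (auto simp: out_degree_def intro: diff_le_mono)
    \<comment> \<open>For \<open>p = []\<close> the removed pair involves the unspecified
      \<open>last []\<close>. Removing it still costs at most one arc, so both cases get the same
      bound.\<close>
    also have "\<dots> \<le> card (out_arcs G (awlast u p) - {(awlast u p, fst (last p))})"
      using diff_card_le_card_Diff[of "{(awlast u p, fst (last p))}"] by simp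
    also have "\<dots> \<le> card (ext p)"
      by (rule card_mono) (auto simp: ext_def)
    finally show ?thesis .
  qed
  let ?snoc = "\<lambda>(p, e). p @ [e]"
  have "(k - 1) ^ Suc t \<le> card (progressing_walks G u t) * (k - 1)"
    using Suc.IH by (simp add: mult.commute)
  also have "\<dots> \<le> (\<Sum>p\<in>progressing_walks G u t. card (ext p))"
    using sum_bounded_below[of "progressing_walks G u t" "k - 1" "\<lambda>p. card (ext p)"] ext_ge by simp
  also have "\<dots> = card (SIGMA p:progressing_walks G u t. ext p)"
    by (rule card_SigmaI[symmetric]) (auto simp: finite_progressing_walks ext_def)
  also have "\<dots> = card (?snoc ` (SIGMA p:progressing_walks G u t. ext p))"
    by (rule card_image[symmetric]) (auto simp: inj_on_def)
  also have "\<dots> \<le> card (progressing_walks G u (Suc t))"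
  proof (rule card_mono[OF finite_progressing_walks], clarsimp)
    fix p x y assume p: "p \<in> progressing_walks G u t" and e: "(x, y) \<in> ext p"
    then obtain v where v: "awalk u p v" by (auto simp: progressing_walks_def)
    with e have "awalk u (p @ [(x, y)]) y"
      by (auto simp: ext_def awalk_simps dest: in_arcsD2)
    moreover have "progressing (p @ [(x, y)])"
      using p e by (auto simp: progressing_walks_def ext_def progressing_append_iff progressing_single)
    ultimately show "p @ [(x, y)] \<in> progressing_walks G u (Suc t)"
      using p by (auto simp: progressing_walks_def)
  qed
  finally show ?case .
qed

text \<open>The girth makes the end point map injective on non-backtracking walks of length
  \<open>t\<close>, so there are at least as many end points as such walks.\<close>

lemma (in pair_graph) card_relpow_neighbourhood_ge:
  assumes deg: "\<And>v. v \<in> pverts G \<Longrightarrow> k \<le> out_degree G v"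
    and girth: "enat (2 * t) < girth G" and u: "u \<in> pverts G"
  shows "(k - 1) ^ t \<le> card {v \<in> pverts G. (u, v) \<in> parcs G ^^ t}"
proof -
  have "(k - 1) ^ t \<le> card (progressing_walks G u t)"
    using deg u by (rule card_progressing_walks_ge)
  also have "\<dots> \<le> card {v \<in> pverts G. (u, v) \<in> parcs G ^^ t}"
  proof (rule card_inj_on_le)
    show "inj_on (awlast u) (progressing_walks G u t)"
    proof (rule inj_onI)
      fix p q
      assume "p \<in> progressing_walks G u t" "q \<in> progressing_walks G u t" "awlast u p = awlast u q"
      then obtain v where "awalk u p v" "awalk u q v" "progressing p" "progressing q"
        "length p = t" "length q = t"
        by (auto simp: progressing_walks_def)
      then show "p = q"
        using girth by (intro progressing_walk_unique) simp_all
    qed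
    show "awlast u ` progressing_walks G u t \<subseteq> {v \<in> pverts G. (u, v) \<in> parcs G ^^ t}"
    proof clarify
      fix p assume "p \<in> progressing_walks G u t"
      then obtain v where "awalk u p v" "length p = t"
        by (auto simp: progressing_walks_def)
      then show "awlast u p \<in> pverts G \<and> (u, awlast u p) \<in> parcs G ^^ t"
        using relpow_iff_awalk[OF u] by auto
    qed
    show "finite {v \<in> pverts G. (u, v) \<in> parcs G ^^ t}"
      by (simp add: pair_finite_verts)
  qed
  finally show ?thesis .
qed

section \<open>Greedy domination\<close>

text \<open>Averaging: every undominated vertex has at least \<open>b\<close> dominators, so some
  vertex dominates at least a fraction \<open>b / card V\<close> of the undominated set. Adding such
  a vertex multiplies the size of that set by at most \<open>1 - b / card V\<close>; this is done
  \<open>m\<close> times.\<close>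

lemma greedy_domination:
  fixes V :: "'a set" and b :: nat
  assumes V: "finite V" "V \<noteq> {}"
    and b: "\<And>v. v \<in> V \<Longrightarrow> b \<le> card {s \<in> V. (s, v) \<in> R}"
  shows "\<exists>S\<subseteq>V. card S \<le> m \<and>
    real (card {v \<in> V. \<forall>s\<in>S. (s, v) \<notin> R}) \<le> card V * (1 - b / card V) ^ m"
proof (induction m)
  case 0
  show ?case by (intro exI[of _ "{}"]) auto
next
  case (Suc m)
  then obtain S where S: "S \<subseteq> V" "card S \<le> m"
    and U: "real (card {v \<in> V. \<forall>s\<in>S. (s, v) \<notin> R}) \<le> card V * (1 - b / card V) ^ m"
    by blast
  define U where "U = {v \<in> V. \<forall>s\<in>S. (s, v) \<notin> R}"
  define c where "c s = card {v \<in> U. (s, v) \<in> R}" for s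
  have fin: "finite U" and n: "card V > 0"
    using V by (auto simp: U_def card_gt_0_iff)
  \<comment> \<open>Double counting of the pairs in \<open>R\<close> from \<open>V\<close> to the
    undominated set \<open>U\<close>.\<close>
  have "card U * b \<le> (\<Sum>v\<in>U. card {s \<in> V. (s, v) \<in> R})"
    using sum_bounded_below[of U b "\<lambda>v. card {s \<in> V. (s, v) \<in> R}"] b by (simp add: U_def)
  also have "\<dots> = (\<Sum>s\<in>V. c s)"
    unfolding c_def using V fin by (intro sum_multicount_gen) auto
  finally have avg: "card U * b \<le> (\<Sum>s\<in>V. c s)" .
  obtain s where s: "s \<in> V" "card U * b \<le> card V * c s"
  proof -
    have "\<exists>s\<in>V. card U * b \<le> card V * c s"
    proof (rule ccontr)
      assume "\<not> ?thesis"
      then have "(\<Sum>s\<in>V. card V * c s) < (\<Sum>s\<in>V. card U * b)"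
        using V by (intro sum_strict_mono) (auto simp: not_le)
      then show False
        using avg n by (simp flip: sum_distrib_left)
    qed
    then show ?thesis using that by blast
  qed
  have eq: "{v \<in> V. \<forall>s'\<in>insert s S. (s', v) \<notin> R} = U - {v \<in> U. (s, v) \<in> R}"
    by (auto simp: U_def)
  have "real (card {v \<in> V. \<forall>s'\<in>insert s S. (s', v) \<notin> R}) = real (card U) - real (c s)"
    unfolding eq c_def using fin by (subst card_Diff_subset) (auto intro!: of_nat_diff card_mono)
  also have "\<dots> \<le> real (card U) * (1 - b / card V)"
  proof -
    have "real (card U) * real b \<le> real (card V) * real (c s)"
      using s(2) by (metis of_nat_le_iff of_nat_mult)
    then show ?thesis using n by (simp add: field_simps)
  qed
  also have "\<dots> \<le> card V * (1 - b / card V) ^ m * (1 - b / card V)"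
  proof (rule mult_right_mono)
    show "real (card U) \<le> card V * (1 - b / card V) ^ m"
      using U by (simp add: U_def)
    \<comment> \<open>The factor has to be nonnegative for the induction hypothesis to be multiplied
      by it.\<close>
    have "b \<le> card V"
    proof -
      obtain v where "v \<in> V" using V by blast
      from b[OF this] show ?thesis
        by (rule order_trans) (auto intro: card_mono V)
    qed
    then show "0 \<le> 1 - real b / real (card V)" using n by simp
  qed
  finally have "real (card {v \<in> V. \<forall>s'\<in>insert s S. (s', v) \<notin> R})
      \<le> card V * (1 - b / card V) ^ Suc m"
    by (simp add: mult_ac)
  moreover have "card (insert s S) \<le> Suc m"
    using card_insert_le_m1[of "Suc m" S s] S by simp
  ultimately show ?case
    using S s by (intro exI[of _ "insert s S"]) auto
qed

section \<open>Pebbling\<close>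

text \<open>Repeats one move \<open>n\<close> times. Keeping \<open>D v\<close> in the bound lets
  the gains add up in the induction.\<close>

lemma pebbling_moves_along_arc:
  assumes "(u, v) \<in> parcs G" "u \<noteq> v" "2 * n \<le> D u"
  shows "\<exists>D'. (pebbling_move G)\<^sup>*\<^sup>* D D' \<and> D v + n \<le> D' v"
  using assms(3)
proof (induction n arbitrary: D)
  case 0
  then show ?case by auto
next
  case (Suc n)
  let ?D = "D(u := D u - 2, v := D v + 1)"
  have "pebbling_move G D ?D"
    using Suc.prems assms(1) by (intro pebbling_move.intros) auto
  moreover obtain D' where "(pebbling_move G)\<^sup>*\<^sup>* ?D D'" "?D v + n \<le> D' v"
  proof -
    have "2 * n \<le> ?D u"
      using Suc.prems assms(2) by simp
    with Suc.IH that show ?thesis by blast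
  qed
  ultimately show ?case
    by (intro exI[of _ D']) (auto intro: converse_rtranclp_into_rtranclp)
qed

text \<open>Each arc of the walk halves the pile: \<open>2 * (2 ^ t * n)\<close> pebbles at the
  start become \<open>2 ^ t * n\<close> at the next vertex, where the induction hypothesis takes
  over.\<close>

lemma (in pair_loopfree_digraph) pebbling_moves_along_walk:
  assumes "(u, v) \<in> parcs G ^^ t" "2 ^ t * n \<le> D u"
  shows "\<exists>D'. (pebbling_move G)\<^sup>*\<^sup>* D D' \<and> n \<le> D' v"
  using assms
proof (induction t arbitrary: u D)
  case 0
  then show ?case by auto
next
  case (Suc t)
  from Suc.prems(1) obtain w where w: "(u, w) \<in> parcs G" "(w, v) \<in> parcs G ^^ t"
    by (metis relpow_Suc_D2)
  obtain D' where D': "(pebbling_move G)\<^sup>*\<^sup>* D D'" "D w + 2 ^ t * n \<le> D' w"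
    using pebbling_moves_along_arc[OF w(1), of "2 ^ t * n" D] pair_no_loops[OF w(1)] Suc.prems(2)
    by (auto simp: mult.assoc)
  obtain D'' where "(pebbling_move G)\<^sup>*\<^sup>* D' D''" "n \<le> D'' v"
    using Suc.IH[OF w(2), of D'] D'(2) by auto
  with D'(1) show ?case
    by (meson rtranclp_trans)
qed

text \<open>A pile of \<open>2 ^ t\<close> can send one pebble to any end of a walk of length
  \<open>t\<close>. Reachability is tested for one vertex at a time, so one pile serves all these
  targets.\<close>

lemma (in pair_digraph) optimal_pebbling_number_le_domination:
  assumes "S \<subseteq> pverts G"
  shows "optimal_pebbling_number G
    \<le> card S * 2 ^ t + card {v \<in> pverts G. \<forall>s\<in>S. (s, v) \<notin> parcs G ^^ t}"
proof -
  define U where "U = {v \<in> pverts G. \<forall>s\<in>S. (s, v) \<notin> parcs G ^^ t}"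
  define D where "D v = (if v \<in> S then 2 ^ t else 0) + (if v \<in> U then 1 else 0 :: nat)" for v
  have "pebbling_reachable G D v" if v: "v \<in> pverts G" for v
  proof (cases "v \<in> U")
    case True
    then show ?thesis
      unfolding pebbling_reachable_def by (intro exI[of _ D]) (auto simp: D_def)
  next
    case False
    then obtain s where "s \<in> S" "(s, v) \<in> parcs G ^^ t"
      using v by (auto simp: U_def)
    then show ?thesis
      unfolding pebbling_reachable_def using pebbling_moves_along_walk[of s v t 1 D]
      by (auto simp: D_def)
  qed
  then have "solvable G D" by (simp add: solvable_def)
  then have "optimal_pebbling_number G \<le> dist_size G D"
    unfolding optimal_pebbling_number_def by (intro Least_le) blast
  also have "dist_size G D = card (pverts G \<inter> S) * 2 ^ t + card (pverts G \<inter> U)"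
    unfolding dist_size_def D_def sum.distrib
    by (simp add: pair_finite_verts flip: sum.inter_restrict)
  also have "\<dots> = card S * 2 ^ t + card U"
  proof -
    have "pverts G \<inter> S = S" "pverts G \<inter> U = U"
      using assms by (auto simp: U_def)
    then show ?thesis by simp
  qed
  finally show ?thesis by (simp add: U_def)
qed

section \<open>The bound on the ratio and its limit\<close>

lemma optimal_pebbling_ratio_le:
  assumes G: "G \<in> graph_family k t" and k: "4 \<le> k"
  shows "real (optimal_pebbling_number G) / card (pverts G)
    \<le> (real t + 1) * (2 / 3) ^ t + exp (- real t)"
proof -
  interpret pair_graph G using G by (simp add: graph_family_def)
  define n where "n = card (pverts G)"
  have ne: "pverts G \<noteq> {}"
    using G by (auto simp: graph_family_def Digraph_Component.connected_def strongly_connected_def)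
  then have n: "n > 0" by (simp add: n_def card_gt_0_iff pair_finite_verts)
  have deg: "k \<le> out_degree G v" if "v \<in> pverts G" for v
  proof -
    have "min_degree G \<le> out_degree G v"
      unfolding min_degree_def using that pair_finite_verts by (intro Min_le) auto
    then show ?thesis using G by (auto simp: graph_family_def)
  qed
  have girth: "enat (2 * t) < girth G"
    using G by (simp add: graph_family_def Suc_ile_eq)
  \<comment> \<open>The greedy choice needs many sources for each target, while the walk count gives
    many targets for each source. Reversing walks exchanges the two.\<close>
  have ball: "3 ^ t \<le> card {s \<in> pverts G. (s, v) \<in> parcs G ^^ t}" if v: "v \<in> pverts G" for v
  proof -
    have "(s, v) \<in> parcs G ^^ t \<longleftrightarrow> (v, s) \<in> parcs G ^^ t" if "s \<in> pverts G" for s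
      unfolding relpow_iff_awalk[OF v] relpow_iff_awalk[OF that]
      by (metis awalk_rev_path' length_rev_path)
    then have "{s \<in> pverts G. (s, v) \<in> parcs G ^^ t} = {s \<in> pverts G. (v, s) \<in> parcs G ^^ t}"
      by blast
    moreover have "(3 :: nat) ^ t \<le> (k - 1) ^ t"
      using k by (intro power_mono) auto
    ultimately show ?thesis
      using card_relpow_neighbourhood_ge[OF deg girth v] by simp
  qed
  have n_ge: "3 ^ t \<le> real n"
  proof -
    obtain v where "v \<in> pverts G" using ne by blast
    from ball[OF this] have "3 ^ t \<le> n"
      unfolding n_def by (rule order_trans) (auto intro: card_mono pair_finite_verts)
    from of_nat_mono[OF this, where 'a = real] show ?thesis by simp
  qed
  \<comment> \<open>The least number of rounds with \<open>m * 3 ^ t / n\<close> at least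
    \<open>t\<close>, so that \<open>(1 - 3 ^ t / n) ^ m\<close> is at most
    \<open>exp (- t)\<close>. Since \<open>n\<close> is at least \<open>3 ^ t\<close>, the 1 lost in
    rounding up is at most \<open>n / 3 ^ t\<close>; this turns \<open>t\<close> into
    \<open>t + 1\<close>.\<close>
  define m where "m = nat \<lceil>real n * t / 3 ^ t\<rceil>"
  have m_ge: "real n * t / 3 ^ t \<le> m" by (simp add: m_def real_nat_ceiling_ge)
  have "real m \<le> real n * t / 3 ^ t + 1"
  proof -
    have "real (nat \<lceil>x\<rceil>) \<le> x + 1" if "0 \<le> x" for x :: real
      using that by linarith
    then show ?thesis by (simp add: m_def)
  qed
  also have "\<dots> \<le> real n * (t + 1) / 3 ^ t"
    using n_ge by (simp add: field_simps)
  finally have m_le: "real m \<le> real n * (t + 1) / 3 ^ t" .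
  obtain S where S: "S \<subseteq> pverts G" "card S \<le> m"
    and U: "real (card {v \<in> pverts G. \<forall>s\<in>S. (s, v) \<notin> parcs G ^^ t}) \<le> n * (1 - 3 ^ t / n) ^ m"
    using greedy_domination[OF pair_finite_verts ne ball, of m] unfolding n_def by auto
  have "(1 - 3 ^ t / n) ^ m \<le> exp (- (3 ^ t / n)) ^ m"
  proof (rule power_mono)
    show "1 - 3 ^ t / real n \<le> exp (- (3 ^ t / n))"
      using exp_ge_add_one_self[of "- (3 ^ t / n)"] by simp
    show "0 \<le> 1 - 3 ^ t / real n"
      using n n_ge by simp
  qed
  also have "\<dots> = exp (- (m * (3 ^ t / n)))"
    by (simp flip: exp_of_nat_mult)
  also have "\<dots> \<le> exp (- real t)"
    using m_ge n by (simp add: field_simps)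
  finally have U': "(1 - 3 ^ t / n) ^ m \<le> exp (- real t)" .
  have "real (optimal_pebbling_number G)
      \<le> real (card S) * 2 ^ t + real (card {v \<in> pverts G. \<forall>s\<in>S. (s, v) \<notin> parcs G ^^ t})"
    using of_nat_mono[OF optimal_pebbling_number_le_domination[OF S(1), of t], where 'a = real]
    by simp
  also have "\<dots> \<le> real n * (t + 1) / 3 ^ t * 2 ^ t + n * exp (- real t)"
  proof (intro add_mono mult_right_mono)
    show "real (card S) \<le> real n * (t + 1) / 3 ^ t"
      using S(2) m_le by linarith
    show "real (card {v \<in> pverts G. \<forall>s\<in>S. (s, v) \<notin> parcs G ^^ t}) \<le> n * exp (- real t)"
      using U U' by (meson mult_left_mono of_nat_0_le_iff order_trans)
  qed auto
  also have "\<dots> = n * ((real t + 1) * (2 / 3) ^ t + exp (- real t))"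
    by (simp add: field_simps)
  finally show ?thesis
    using n by (simp add: n_def[symmetric] divide_le_eq mult.commute)
qed

theorem theorem5:
  fixes k :: nat
  assumes "4 \<le> k"
  shows "((\<lambda>t::nat. SUP G \<in> (graph_family k t :: 'v pair_pre_digraph set).
            ennreal (real (optimal_pebbling_number G) / real (card (pverts G))))
          \<longlonglongrightarrow> 0)"
proof (rule tendsto_sandwich[OF _ _ tendsto_const])
  \<comment> \<open>\<open>exp (- t)\<close> is written as a geometric sequence, so all three terms
    have standard limits.\<close>
  have "(\<lambda>t. real t * (2 / 3) ^ t + (2 / 3) ^ t + exp (- 1) ^ t) \<longlonglongrightarrow> (0 + 0 + 0 :: real)"
    by (intro tendsto_add powser_times_n_limit_0 LIMSEQ_power_zero) auto
  then have "(\<lambda>t. (real t + 1) * (2 / 3) ^ t + exp (- real t)) \<longlonglongrightarrow> 0"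
    by (simp add: algebra_simps flip: exp_of_nat_mult)
  then show "(\<lambda>t. ennreal ((real t + 1) * (2 / 3) ^ t + exp (- real t))) \<longlonglongrightarrow> 0"
    using tendsto_ennrealI by fastforce
  \<comment> \<open>The bound depends on \<open>t\<close> alone and so passes to the supremum; over
    an empty family the supremum in \<open>ennreal\<close> is 0.\<close>
  show "\<forall>\<^sub>F t in sequentially. (SUP G \<in> (graph_family k t :: 'v pair_pre_digraph set).
      ennreal (real (optimal_pebbling_number G) / real (card (pverts G))))
      \<le> ennreal ((real t + 1) * (2 / 3) ^ t + exp (- real t))"
    using optimal_pebbling_ratio_le[OF _ assms]
    by (intro always_eventually allI SUP_least ennreal_leI)
qed simp

end
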